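(* Let $n\in\mathbb N$, $k\in\{1,\dots,n\}$ and $x\in\mathbb R^n$. The solution of the problem $$\min_{y\in\mathbb R^n}\ \|x-y\|_2^2\quad\text{subject to}\quad y\ge 0\ \text{ and }\ \|y\|_0\le k$$ is $y_*=H_k(x^+)=H_k(\max(x,0))$.
   Context: $\|y\|_0$ is the number of nonzero entries of $y$; inequalities and maxima of vectors are entrywise, and $x^+=\max(x,0)$. For $z\in\mathbb R^n$ and $k\in\{1,\dots,n\}$, the sparsifying operator $H_k$ is defined by letting $H_k(z)\in\mathbb R^n$ be the vector that agrees with $z$ on $\mathcal J$ and is zero elsewhere, where $\mathcal J=\mathcal J(z,k)\subseteq\{1,\dots,n\}$ is an index set corresponding to the $k$ largest components of $z$ in absolute value. *)

theory Defs
  imports "HOL-Analysis.Analysis"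
begin

definition l0_norm :: "real ^ 'n \<Rightarrow> nat" where
  "l0_norm y = card {i. y $ i \<noteq> 0}"

(* The library's max on vectors is not entrywise, hence the componentwise definition. *)
definition pos_part :: "real ^ 'n \<Rightarrow> real ^ 'n" where
  "pos_part x = (\<chi> i. max (x $ i) 0)"

definition largest_index_set :: "real ^ 'n \<Rightarrow> nat \<Rightarrow> 'n set \<Rightarrow> bool" where
  "largest_index_set z k I \<longleftrightarrow> card I = k \<and> (\<forall>i\<in>I. \<forall>j\<in>- I. \<bar>z $ j\<bar> \<le> \<bar>z $ i\<bar>)"

(* With ties in absolute value the index set J(z,k) is not determined by z and k.
   The sparsifying operator is therefore parametrised by a rule J that picks one
   admissible index set for each z and k; how ties are broken is left open. *)
definition index_selection :: "(real ^ 'n \<Rightarrow> nat \<Rightarrow> 'n set) \<Rightarrow> bool" where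
  "index_selection J \<longleftrightarrow> (\<forall>z. \<forall>k\<in>{1..CARD('n)}. largest_index_set z k (J z k))"

definition sparsify :: "(real ^ 'n \<Rightarrow> nat \<Rightarrow> 'n set) \<Rightarrow> nat \<Rightarrow> real ^ 'n \<Rightarrow> real ^ 'n" where
  "sparsify J k z = (\<chi> i. if i \<in> J z k then z $ i else 0)"

lemma ex_largest_index_set:
  fixes z :: "real ^ 'n"
  assumes "k \<le> CARD('n)"
  shows "\<exists>I. largest_index_set z k I"
  using assms
proof (induction k)
  case 0
  then show ?case by (auto simp: largest_index_set_def)
next
  case (Suc k)
  then obtain I where I: "card I = k" "\<forall>i\<in>I. \<forall>j\<in>- I. \<bar>z $ j\<bar> \<le> \<bar>z $ i\<bar>"
    by (auto simp: largest_index_set_def)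
  have "I \<noteq> UNIV"
    using I(1) Suc.prems by auto
  then have "finite (- I)" "- I \<noteq> {}"
    by auto
  then obtain m where m: "m \<in> - I" "\<And>j. j \<in> - I \<Longrightarrow> \<bar>z $ j\<bar> \<le> \<bar>z $ m\<bar>"
    using ex_is_arg_min_if_finite[of "- I" "\<lambda>j. - \<bar>z $ j\<bar>"]
    by (auto simp: is_arg_min_linorder)
  have "card (insert m I) = Suc k"
    using m(1) I(1) by simp
  then have "largest_index_set z (Suc k) (insert m I)"
    using m I(2) by (auto simp: largest_index_set_def)
  then show ?case ..
qed

lemma ex_index_selection: "\<exists>J :: real ^ 'n \<Rightarrow> nat \<Rightarrow> 'n set. index_selection J"
proof
  show "index_selection (\<lambda>(z :: real ^ 'n) k. SOME I. largest_index_set z k I)"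
    unfolding index_selection_def
    by (auto intro: someI_ex[OF ex_largest_index_set])
qed

(* Here the order on vectors is the library's entrywise one and norm is the
   Euclidean norm. *)
definition sparse_nonneg_projection :: "real ^ 'n \<Rightarrow> nat \<Rightarrow> real ^ 'n \<Rightarrow> bool" where
  "sparse_nonneg_projection x k =
     is_arg_min (\<lambda>y. (norm (x - y))\<^sup>2) (\<lambda>y. 0 \<le> y \<and> l0_norm y \<le> k)"

end

theory Submission
  imports Defs
begin

text \<open>
  If \<open>y \<ge> 0\<close> is supported in an index set \<open>T\<close> with \<open>k\<close> elements and \<open>p = x\<^sup>+\<close>, then
  \<open>\<parallel>x - y\<parallel>\<^sup>2\<close> exceeds \<open>\<parallel>x\<parallel>\<^sup>2 - (\<Sum>i\<in>T. p\<^sub>i\<^sup>2)\<close> by a nonnegative defect that vanishes exactly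
  when \<open>y\<close> is the restriction of \<open>p\<close> to \<open>T\<close>. So the problem reduces to maximising
  \<open>\<Sum>i\<in>T. p\<^sub>i\<^sup>2\<close> over \<open>T\<close>, and by an exchange argument the maximisers are exactly the index sets
  of \<open>k\<close> largest entries of \<open>p\<close>.
\<close>

text \<open>Equal cardinalities make \<open>B - A\<close> and \<open>A - B\<close> equinumerous. A
  bijection between them sends each index to one where \<open>f\<close> is at least as large, and
  \<open>A \<inter> B\<close> contributes the same to both sums.\<close>

lemma sum_le_sum_if_dominating:
  fixes f :: "'a \<Rightarrow> 'b :: ordered_comm_monoid_add"
  assumes fin: "finite A" "finite B" and card: "card B = card A"
    and dom: "\<And>i j. i \<in> A \<Longrightarrow> j \<in> - A \<Longrightarrow> f j \<le> f i"
  shows "sum f B \<le> sum f A"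
proof -
  have "card (B - A) = card (A - B)"
    using fin card by (simp add: card_Diff_subset_Int Int_commute)
  then obtain h where h: "bij_betw h (B - A) (A - B)"
    using finite_same_card_bij[of "B - A" "A - B"] fin by auto
  have "sum f (B - A) \<le> (\<Sum>i\<in>B - A. f (h i))"
    using bij_betwE[OF h] by (intro sum_mono dom) auto
  also have "\<dots> = sum f (A - B)"
    by (rule sum.reindex_bij_betw[OF h])
  finally have "sum f (B - A) + sum f (B \<inter> A) \<le> sum f (A - B) + sum f (B \<inter> A)"
    by (rule add_right_mono)
  then show ?thesis
    using sum.Int_Diff[OF fin(1), of f B] sum.Int_Diff[OF fin(2), of f A]
    by (simp add: add.commute Int_commute)
qed

text \<open>Taking the index set as an argument, not through a selection rule, allows comparison
  with arbitrary candidate supports.\<close>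

definition restrict_vec :: "'n set \<Rightarrow> real ^ 'n \<Rightarrow> real ^ 'n" where
  "restrict_vec I z = (\<chi> i. if i \<in> I then z $ i else 0)"

lemma sparsify_eq_restrict_vec: "sparsify J k z = restrict_vec (J z k) z"
  by (simp add: sparsify_def restrict_vec_def)

lemma l0_norm_restrict_vec_le: "l0_norm (restrict_vec I z) \<le> card I"
  unfolding l0_norm_def by (rule card_mono) (auto simp: restrict_vec_def)

lemma restrict_vec_pos_part_nonneg: "0 \<le> restrict_vec I (pos_part x)"
  by (simp add: less_eq_vec_def restrict_vec_def pos_part_def)

text \<open>Write x = p + m with p the positive part, m = \<open>min (x $ i) 0\<close> and p * m = 0
  entrywise. Then (x - y)^2 - x^2 = (p - y)^2 - 2 * m * y - p^2, and both sides vanish wherever y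
  and p do. Off \<open>T\<close> only y = 0 is used: there (x - y)^2 - x^2 = 0.\<close>

lemma power2_norm_diff_eq:
  fixes x y :: "real ^ 'n"
  assumes supp: "{i. y $ i \<noteq> 0} \<subseteq> T"
  shows "(norm (x - y))\<^sup>2 = (norm x)\<^sup>2 - (\<Sum>i\<in>T. (pos_part x $ i)\<^sup>2)
    + (\<Sum>i\<in>T. (pos_part x $ i - y $ i)\<^sup>2 - 2 * min (x $ i) 0 * y $ i)"
proof -
  have norm_sq: "(norm v)\<^sup>2 = (\<Sum>i\<in>UNIV. (v $ i)\<^sup>2)" for v :: "real ^ 'n"
    unfolding power2_norm_eq_inner by (simp add: inner_vec_def power2_eq_square)
  have "(norm (x - y))\<^sup>2 - (norm x)\<^sup>2 = (\<Sum>i\<in>UNIV. (x $ i - y $ i)\<^sup>2 - (x $ i)\<^sup>2)"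
    by (simp add: norm_sq sum_subtractf)
  also have "\<dots> = (\<Sum>i\<in>T. (x $ i - y $ i)\<^sup>2 - (x $ i)\<^sup>2)"
  proof (rule sum.mono_neutral_right)
    show "\<forall>i\<in>UNIV - T. (x $ i - y $ i)\<^sup>2 - (x $ i)\<^sup>2 = 0"
    proof
      fix i
      assume "i \<in> UNIV - T"
      then have "y $ i = 0"
        using supp by auto
      then show "(x $ i - y $ i)\<^sup>2 - (x $ i)\<^sup>2 = 0"
        by simp
    qed
  qed auto
  also have "\<dots> = (\<Sum>i\<in>T. ((pos_part x $ i - y $ i)\<^sup>2 - 2 * min (x $ i) 0 * y $ i)
      - (pos_part x $ i)\<^sup>2)"
    by (intro sum.cong refl)
      (auto simp: pos_part_def max_def min_def power2_eq_square algebra_simps)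
  finally show ?thesis
    by (simp add: sum_subtractf)
qed

lemma power2_norm_diff_restrict_vec_pos_part:
  fixes x :: "real ^ 'n"
  shows "(norm (x - restrict_vec T (pos_part x)))\<^sup>2
    = (norm x)\<^sup>2 - (\<Sum>i\<in>T. (pos_part x $ i)\<^sup>2)"
proof -
  have "(\<Sum>i\<in>T. (pos_part x $ i - restrict_vec T (pos_part x) $ i)\<^sup>2
      - 2 * min (x $ i) 0 * restrict_vec T (pos_part x) $ i) = 0"
    by (intro sum.neutral) (auto simp: restrict_vec_def pos_part_def max_def min_def)
  then show ?thesis
    by (subst power2_norm_diff_eq[of _ T]) (auto simp: restrict_vec_def)
qed

lemma restrict_vec_pos_part_optimal:
  fixes x y :: "real ^ 'n"
  assumes y: "0 \<le> y" and supp: "{i. y $ i \<noteq> 0} \<subseteq> T"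
  shows "(norm (x - restrict_vec T (pos_part x)))\<^sup>2 \<le> (norm (x - y))\<^sup>2"
    and "(norm (x - y))\<^sup>2 \<le> (norm (x - restrict_vec T (pos_part x)))\<^sup>2
      \<Longrightarrow> y = restrict_vec T (pos_part x)"
proof -
  define d where "d i = (pos_part x $ i - y $ i)\<^sup>2 - 2 * min (x $ i) 0 * y $ i" for i
  \<comment> \<open>Since \<open>y $ i\<close> \<ge> 0 and \<open>min (x $ i) 0\<close> \<le> 0, the
    cross term only adds to the square; hence \<open>d i = 0\<close> forces \<open>y $ i\<close> to
    equal the positive part.\<close>
  have d_ge: "(pos_part x $ i - y $ i)\<^sup>2 \<le> d i" for i
    using y by (simp add: d_def less_eq_vec_def mult_nonpos_nonneg)
  then have d_nonneg: "0 \<le> d i" for i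
    by (rule order_trans[OF zero_le_power2])
  have eq: "(norm (x - y))\<^sup>2 = (norm (x - restrict_vec T (pos_part x)))\<^sup>2 + sum d T"
    by (simp add: power2_norm_diff_eq[OF supp] power2_norm_diff_restrict_vec_pos_part d_def)
  show "(norm (x - restrict_vec T (pos_part x)))\<^sup>2 \<le> (norm (x - y))\<^sup>2"
    by (simp add: eq d_nonneg sum_nonneg)
  assume "(norm (x - y))\<^sup>2 \<le> (norm (x - restrict_vec T (pos_part x)))\<^sup>2"
  then have "sum d T = 0"
    using sum_nonneg[of T d] d_nonneg eq by simp
  then have "pos_part x $ i = y $ i" if "i \<in> T" for i
    using that d_nonneg d_ge[of i] by (simp add: sum_nonneg_eq_0_iff)
  then show "y = restrict_vec T (pos_part x)"
    using supp by (auto simp: vec_eq_iff restrict_vec_def)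
qed

text \<open>Padding the support to exactly \<open>k\<close> indices makes it comparable with the
  sets of \<open>largest_index_set\<close>, which have cardinality exactly \<open>k\<close>.\<close>

lemma ex_support_superset:
  fixes y :: "real ^ 'n"
  assumes "l0_norm y \<le> k" "k \<le> CARD('n)"
  obtains T where "{i. y $ i \<noteq> 0} \<subseteq> T" "card T = k"
  using exists_subset_between[of "{i. y $ i \<noteq> 0}" k UNIV] assms
  by (auto simp: l0_norm_def)

lemma sparse_nonneg_projection_restrict_vec:
  fixes x :: "real ^ 'n"
  assumes k: "k \<le> CARD('n)" and I: "largest_index_set (pos_part x) k I"
  shows "sparse_nonneg_projection x k (restrict_vec I (pos_part x))"
proof -
  have "(norm (x - restrict_vec I (pos_part x)))\<^sup>2 \<le> (norm (x - y))\<^sup>2"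
    if y: "0 \<le> y" "l0_norm y \<le> k" for y
  proof -
    obtain T where T: "{i. y $ i \<noteq> 0} \<subseteq> T" "card T = k"
      using ex_support_superset[OF y(2) k] .
    \<comment> \<open>Dominance in absolute value is dominance of squares, so the exchange lemma
      applies to \<open>I\<close> and \<open>T\<close>.\<close>
    have "(\<Sum>i\<in>T. (pos_part x $ i)\<^sup>2) \<le> (\<Sum>i\<in>I. (pos_part x $ i)\<^sup>2)"
      using I T(2) by (intro sum_le_sum_if_dominating)
        (auto simp: largest_index_set_def abs_le_square_iff)
    then have "(norm (x - restrict_vec I (pos_part x)))\<^sup>2
        \<le> (norm (x - restrict_vec T (pos_part x)))\<^sup>2"
      by (simp add: power2_norm_diff_restrict_vec_pos_part)
    also have "\<dots> \<le> (norm (x - y))\<^sup>2"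
      by (rule restrict_vec_pos_part_optimal(1)[OF y(1) T(1)])
    finally show ?thesis .
  qed
  moreover have "l0_norm (restrict_vec I (pos_part x)) \<le> k"
    using l0_norm_restrict_vec_le[of I] I by (simp add: largest_index_set_def)
  ultimately show ?thesis
    by (simp add: sparse_nonneg_projection_def is_arg_min_linorder restrict_vec_pos_part_nonneg)
qed

text \<open>A minimiser is tested against two kinds of competitors: the restriction to its own
  padded support \<open>T\<close>, which forces equality with it, and restrictions to sets obtained
  from \<open>T\<close> by one swap, which force \<open>T\<close> to hold largest entries.\<close>

lemma sparse_nonneg_projectionE:
  fixes x y :: "real ^ 'n"
  assumes k: "k \<le> CARD('n)" and y: "sparse_nonneg_projection x k y"
  obtains T where "largest_index_set (pos_part x) k T" "y = restrict_vec T (pos_part x)"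
proof -
  have feas: "0 \<le> y" "l0_norm y \<le> k"
    using y by (auto simp: sparse_nonneg_projection_def is_arg_min_linorder)
  have opt: "(norm (x - y))\<^sup>2 \<le> (norm (x - restrict_vec U (pos_part x)))\<^sup>2"
    if "card U = k" for U
    using y that l0_norm_restrict_vec_le[of U "pos_part x"] restrict_vec_pos_part_nonneg[of U x]
    by (auto simp: sparse_nonneg_projection_def is_arg_min_linorder)
  obtain T where T: "{i. y $ i \<noteq> 0} \<subseteq> T" "card T = k"
    using ex_support_superset[OF feas(2) k] .
  have y_eq: "y = restrict_vec T (pos_part x)"
    by (rule restrict_vec_pos_part_optimal(2)[OF feas(1) T(1) opt[OF T(2)]])
  have "\<bar>pos_part x $ j\<bar> \<le> \<bar>pos_part x $ i\<bar>" if "i \<in> T" "j \<in> - T" for i j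
  proof -
    \<comment> \<open>Swapping \<open>i\<close> for \<open>j\<close> leaves \<open>T - {i}\<close>
      common to both sums, so optimality reduces to comparing the squares at \<open>j\<close> and
      \<open>i\<close>.\<close>
    define U where "U = insert j (T - {i})"
    have "card U = k"
      using that T(2) by (auto simp: U_def card_Suc_Diff1 simp del: card_Diff_insert)
    then have "(\<Sum>l\<in>U. (pos_part x $ l)\<^sup>2) \<le> (\<Sum>l\<in>T. (pos_part x $ l)\<^sup>2)"
      using opt[of U] by (simp add: y_eq power2_norm_diff_restrict_vec_pos_part)
    moreover have "(\<Sum>l\<in>T. (pos_part x $ l)\<^sup>2)
        = (pos_part x $ i)\<^sup>2 + (\<Sum>l\<in>T - {i}. (pos_part x $ l)\<^sup>2)"
      using that by (simp add: sum.remove)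
    ultimately show ?thesis
      using that by (simp add: U_def abs_le_square_iff)
  qed
  then have "largest_index_set (pos_part x) k T"
    using T(2) by (auto simp: largest_index_set_def)
  then show ?thesis
    using y_eq that by blast
qed

text \<open>Any way of breaking ties at one pair \<open>z\<close>, \<open>k\<close> is realised by
  overriding an existing rule at that pair alone.\<close>

lemma index_selection_extend:
  fixes z :: "real ^ 'n"
  assumes "largest_index_set z k T"
  obtains J where "index_selection J" "J z k = T"
proof -
  obtain J\<^sub>0 :: "real ^ 'n \<Rightarrow> nat \<Rightarrow> 'n set" where "index_selection J\<^sub>0"
    using ex_index_selection by blast
  then have "index_selection (J\<^sub>0(z := (J\<^sub>0 z)(k := T)))"
    using assms by (auto simp: index_selection_def)
  then show ?thesis
    by (rule that) simp
qed

theorem lemma2p1: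
  fixes x :: "real ^ 'n" and k :: nat
  assumes "k \<in> {1..CARD('n)}"
  shows "(\<forall>J. index_selection J \<longrightarrow> sparse_nonneg_projection x k (sparsify J k (pos_part x))) \<and>
    (\<forall>y. sparse_nonneg_projection x k y \<longrightarrow>
      (\<exists>J. index_selection J \<and> y = sparsify J k (pos_part x)))"
proof (intro conjI allI impI)
  fix J :: "real ^ 'n \<Rightarrow> nat \<Rightarrow> 'n set"
  assume "index_selection J"
  then show "sparse_nonneg_projection x k (sparsify J k (pos_part x))"
    using assms unfolding sparsify_eq_restrict_vec index_selection_def
    by (intro sparse_nonneg_projection_restrict_vec) simp_all
next
  fix y
  assume "sparse_nonneg_projection x k y"
  then obtain T where T: "largest_index_set (pos_part x) k T" "y = restrict_vec T (pos_part x)"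
    using assms sparse_nonneg_projectionE by (metis atLeastAtMost_iff)
  obtain J where "index_selection J" "J (pos_part x) k = T"
    using index_selection_extend[OF T(1)] .
  then show "\<exists>J. index_selection J \<and> y = sparsify J k (pos_part x)"
    using T(2) by (auto simp: sparsify_eq_restrict_vec)
qed

end
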